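(* Let $x$ be a positive real number. The generating functions $G_T(y)=\sum_{n=0}^{\infty}Q_{T,n}(x)y^n$ and $g_t(y)=\sum_{n=0}^{\infty}Q_{t,n}(x)y^n$ of the Tribonacci and Tribonacci-Lucas quaternion polynomials are $$G_T(y)=\frac{y+\mathbf{i}+(x^2+xy+y^2)\mathbf{j}+(x^4+x+x^3y+y+x^2y^2)\mathbf{k}}{1-x^2y-xy^2-y^3}$$ and $$g_t(y)=\frac{3-2x^2y-xy^2+(x^2+2xy+3y^2)\mathbf{i}+(x^4+2x+x^3y+3y+x^2y^2)\mathbf{j}+(x^6+3x^3+3+x^5y+3x^2y+x^4y^2+2xy^2)\mathbf{k}}{1-x^2y-xy^2-y^3},$$ respectively.
   Context: The Tribonacci polynomials $T_n(x)$ and Tribonacci-Lucas polynomials $t_n(x)$ are defined by $T_0(x)=0$, $T_1(x)=1$, $T_2(x)=x^2$, $t_0(x)=3$, $t_1(x)=x^2$, $t_2(x)=x^4+2x$, and for $n\ge 3$: $T_n(x)=x^2T_{n-1}(x)+xT_{n-2}(x)+T_{n-3}(x)$ and $t_n(x)=x^2t_{n-1}(x)+xt_{n-2}(x)+t_{n-3}(x)$. Let $\mathbf{i},\mathbf{j},\mathbf{k}$ be the quaternion units, with $\mathbf{i}^2=\mathbf{j}^2=\mathbf{k}^2=\mathbf{i}\mathbf{j}\mathbf{k}=-1$. For $n\ge 0$, the Tribonacci quaternion polynomials are $Q_{T,n}(x)=T_n(x)+T_{n+1}(x)\mathbf{i}+T_{n+2}(x)\mathbf{j}+T_{n+3}(x)\mathbf{k}$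 and the Tribonacci-Lucas quaternion polynomials are $Q_{t,n}(x)=t_n(x)+t_{n+1}(x)\mathbf{i}+t_{n+2}(x)\mathbf{j}+t_{n+3}(x)\mathbf{k}$. Generating functions are formal power series in an indeterminate $y$ that commutes with all quaternions; dividing by $1-x^2y-xy^2-y^3$ means multiplying by its inverse power series (which has real coefficients). *)

theory Defs
  imports Complex_Main
    "HOL-Computational_Algebra.Polynomial"
    "HOL-Computational_Algebra.Formal_Power_Series"
begin

text \<open>\<open>Quat a b c d\<close> is the quaternion $a + b\mathbf{i} + c\mathbf{j} + d\mathbf{k}$.\<close>

datatype quat = Quat (qre: real) (qim1: real) (qim2: real) (qim3: real)

lemma quat_eq_iff:
  "p = q \<longleftrightarrow> qre p = qre q \<and> qim1 p = qim1 q \<and> qim2 p = qim2 q \<and> qim3 p = qim3 q"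
  by (auto intro: quat.expand)

instantiation quat :: real_vector
begin

definition "0 = Quat 0 0 0 0"
definition "p + q = Quat (qre p + qre q) (qim1 p + qim1 q) (qim2 p + qim2 q) (qim3 p + qim3 q)"
definition "p - q = Quat (qre p - qre q) (qim1 p - qim1 q) (qim2 p - qim2 q) (qim3 p - qim3 q)"
definition "- p = Quat (- qre p) (- qim1 p) (- qim2 p) (- qim3 p)"
definition "scaleR r p = Quat (r * qre p) (r * qim1 p) (r * qim2 p) (r * qim3 p)"

instance
  by standard
    (auto simp: zero_quat_def plus_quat_def minus_quat_def uminus_quat_def scaleR_quat_def
      algebra_simps quat_eq_iff)

end

instantiation quat :: real_algebra_1
begin

definition "1 = Quat 1 0 0 0"

definition "p * q = Quat
  (qre p * qre q - qim1 p * qim1 q - qim2 p * qim2 q - qim3 p * qim3 q)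
  (qre p * qim1 q + qim1 p * qre q + qim2 p * qim3 q - qim3 p * qim2 q)
  (qre p * qim2 q - qim1 p * qim3 q + qim2 p * qre q + qim3 p * qim1 q)
  (qre p * qim3 q + qim1 p * qim2 q - qim2 p * qim1 q + qim3 p * qre q)"

instance
  by standard
    (auto simp: zero_quat_def one_quat_def plus_quat_def scaleR_quat_def times_quat_def
      algebra_simps quat_eq_iff)

end

definition quat_normsq :: "quat \<Rightarrow> real" where
  "quat_normsq p = (qre p)\<^sup>2 + (qim1 p)\<^sup>2 + (qim2 p)\<^sup>2 + (qim3 p)\<^sup>2"

lemma quat_normsq_eq_0_iff: "quat_normsq p = 0 \<longleftrightarrow> p = 0"
  by (auto simp: quat_normsq_def zero_quat_def quat_eq_iff add_nonneg_eq_0_iff)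

instantiation quat :: division_ring
begin

definition "inverse p =
  (1 / quat_normsq p) *\<^sub>R Quat (qre p) (- qim1 p) (- qim2 p) (- qim3 p)"
definition "p div (q :: quat) = p * inverse q"

instance
proof
  fix p :: quat
  assume "p \<noteq> 0"
  then have nz: "quat_normsq p \<noteq> 0"
    by (simp add: quat_normsq_eq_0_iff)
  let ?c = "Quat (qre p) (- qim1 p) (- qim2 p) (- qim3 p)"
  have "?c * p = quat_normsq p *\<^sub>R 1" "p * ?c = quat_normsq p *\<^sub>R 1"
    by (simp_all add: times_quat_def one_quat_def scaleR_quat_def quat_normsq_def
        power2_eq_square)
  then show "inverse p * p = 1" "p * inverse p = 1"
    using nz by (simp_all add: inverse_quat_def)
qed (simp_all add: divide_quat_def inverse_quat_def zero_quat_def scaleR_quat_def)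

end

definition quat_i :: quat where "quat_i = Quat 0 1 0 0"
definition quat_j :: quat where "quat_j = Quat 0 0 1 0"
definition quat_k :: quat where "quat_k = Quat 0 0 0 1"

lemma quat_unit_relations:
  "quat_i\<^sup>2 = -1" "quat_j\<^sup>2 = -1" "quat_k\<^sup>2 = -1" "quat_i * quat_j * quat_k = -1"
  by (simp_all add: quat_i_def quat_j_def quat_k_def power2_eq_square times_quat_def
      uminus_quat_def one_quat_def)

lemma Quat_eq:
  "Quat a b c d = of_real a + of_real b * quat_i + of_real c * quat_j + of_real d * quat_k"
  by (simp add: of_real_def quat_i_def quat_j_def quat_k_def times_quat_def
      plus_quat_def scaleR_quat_def one_quat_def)

fun tribonacci_poly :: "nat \<Rightarrow> real poly" where
  "tribonacci_poly 0 = 0"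
| "tribonacci_poly (Suc 0) = 1"
| "tribonacci_poly (Suc (Suc 0)) = monom 1 2"
| "tribonacci_poly (Suc (Suc (Suc n))) =
     monom 1 2 * tribonacci_poly (Suc (Suc n)) + monom 1 1 * tribonacci_poly (Suc n)
       + tribonacci_poly n"

fun tribonacci_lucas_poly :: "nat \<Rightarrow> real poly" where
  "tribonacci_lucas_poly 0 = 3"
| "tribonacci_lucas_poly (Suc 0) = monom 1 2"
| "tribonacci_lucas_poly (Suc (Suc 0)) = monom 1 4 + monom 2 1"
| "tribonacci_lucas_poly (Suc (Suc (Suc n))) =
     monom 1 2 * tribonacci_lucas_poly (Suc (Suc n)) + monom 1 1 * tribonacci_lucas_poly (Suc n)
       + tribonacci_lucas_poly n"

definition tribonacci_quat :: "nat \<Rightarrow> real \<Rightarrow> quat" where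
  "tribonacci_quat n x =
     of_real (poly (tribonacci_poly n) x)
     + of_real (poly (tribonacci_poly (n + 1)) x) * quat_i
     + of_real (poly (tribonacci_poly (n + 2)) x) * quat_j
     + of_real (poly (tribonacci_poly (n + 3)) x) * quat_k"

definition tribonacci_lucas_quat :: "nat \<Rightarrow> real \<Rightarrow> quat" where
  "tribonacci_lucas_quat n x =
     of_real (poly (tribonacci_lucas_poly n) x)
     + of_real (poly (tribonacci_lucas_poly (n + 1)) x) * quat_i
     + of_real (poly (tribonacci_lucas_poly (n + 2)) x) * quat_j
     + of_real (poly (tribonacci_lucas_poly (n + 3)) x) * quat_k"

text \<open>
  Generating functions live in the ring \<open>quat fps\<close>; its indeterminate \<open>fps_X\<close> commutes with
  every quaternion constant.
\<close>

definition tribonacci_quat_gf :: "real \<Rightarrow> quat fps" where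
  "tribonacci_quat_gf x = Abs_fps (\<lambda>n. tribonacci_quat n x)"

definition tribonacci_lucas_quat_gf :: "real \<Rightarrow> quat fps" where
  "tribonacci_lucas_quat_gf x = Abs_fps (\<lambda>n. tribonacci_lucas_quat n x)"

end

theory Submission
  imports Defs
begin

text \<open>
  A sequence with a linear recurrence \<open>f (n + 3) = f (n + 2) a + f (n + 1) b + f n c\<close> has a
  rational generating function: multiplying \<open>\<Sum> f n y^n\<close> by \<open>1 - a y - b y^2 - c y^3\<close> kills every
  coefficient from \<open>y^3\<close> on, and the three surviving ones depend only on \<open>f 0\<close>, \<open>f 1\<close>, \<open>f 2\<close>
  (\<open>third_order_recurrence_gf_mult\<close>). Over a division ring the denominator is invertible since its
  constant term is \<open>1\<close> (\<open>third_order_recurrence_gf\<close>).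

  The components of both quaternion sequences are shifts of one real sequence satisfying the
  recurrence with \<open>a = x^2\<close>, \<open>b = x\<close>, \<open>c = 1\<close>, so the quaternions satisfy it too
  (\<open>tribonacci_quat_rec\<close>, \<open>tribonacci_lucas_quat_rec\<close>). It remains to compute the three numerator
  coefficients from the initial values. Although quaternions do not commute, nothing goes wrong:
  the coefficients of the recurrence are real, hence central, and \<open>y\<close> commutes with all constants.
\<close>

text \<open>
  The coefficients multiply \<open>f\<close> from the right because the denominator does, so that the
  coefficients of the product are literally the defect \<open>f n - f (n - 1) a - f (n - 2) b - f (n - 3) c\<close>
  of the recurrence, in any noncommutative ring.
\<close>

lemma third_order_recurrence_gf_mult:
  includes fps_syntax
  fixes f :: "nat \<Rightarrow> 'a :: ring_1"
  assumes rec: "\<And>n. f (n + 3) = f (n + 2) * a + f (n + 1) * b + f n * c"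
  shows "Abs_fps f * (1 - fps_const a * fps_X - fps_const b * fps_X ^ 2 - fps_const c * fps_X ^ 3)
       = fps_const (f 0) + fps_const (f 1 - f 0 * a) * fps_X
         + fps_const (f 2 - f 1 * a - f 0 * b) * fps_X ^ 2"
proof (rule fps_ext)
  fix n :: nat
  \<comment> \<open>The truncated shift yields \<open>0\<close> for \<open>n < k\<close>, which is why only \<open>n < 3\<close> escapes the recurrence.\<close>
  have shift: "(Abs_fps f * (fps_const d * fps_X ^ k)) $ n = (if n < k then 0 else f (n - k) * d)"
    for d k
    by (simp add: mult.assoc [symmetric] fps_X_power_mult_right_nth)
  show "(Abs_fps f * (1 - fps_const a * fps_X - fps_const b * fps_X ^ 2 - fps_const c * fps_X ^ 3)) $ n
      = (fps_const (f 0) + fps_const (f 1 - f 0 * a) * fps_X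
         + fps_const (f 2 - f 1 * a - f 0 * b) * fps_X ^ 2) $ n"
  proof -
    consider "n = 0" | "n = 1" | "n = 2" | m where "n = m + 3"
      by (metis One_nat_def Suc_1 add_2_eq_Suc' add.commute less_2_cases_iff
          linorder_not_less le_Suc_ex numeral_3_eq_3 Suc_leI le_neq_implies_less)
    then show ?thesis
      using rec shift [of a 1] shift [of b 2] shift [of c 3]
      by cases (simp_all add: right_diff_distrib fps_X_power_mult_right_nth
          numeral_2_eq_2 numeral_3_eq_3)
  qed
qed

text \<open>
  In a noncommutative ring the inverse has to be cancelled on the side on which the denominator was
  multiplied; an inverse power series over a division ring is two-sided.
\<close>

lemma third_order_recurrence_gf:
  includes fps_syntax
  fixes f :: "nat \<Rightarrow> 'a :: division_ring"
  assumes rec: "\<And>n. f (n + 3) = f (n + 2) * a + f (n + 1) * b + f n * c"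
  shows "Abs_fps f =
       (fps_const (f 0) + fps_const (f 1 - f 0 * a) * fps_X
         + fps_const (f 2 - f 1 * a - f 0 * b) * fps_X ^ 2)
       * inverse (1 - fps_const a * fps_X - fps_const b * fps_X ^ 2 - fps_const c * fps_X ^ 3)"
    (is "_ = ?N * inverse ?D")
proof -
  have "?D $ 0 \<noteq> 0"
    by simp
  then have "?D * inverse ?D = 1"
    by (rule inverse_mult_eq_1')
  then have "Abs_fps f = Abs_fps f * ?D * inverse ?D"
    by (simp add: mult.assoc)
  then show ?thesis
    using third_order_recurrence_gf_mult [of f a b c, OF rec] by simp
qed

lemma of_real_eq_Quat: "of_real r = Quat r 0 0 0"
  by (simp add: Quat_eq)

lemma tribonacci_quat_eq_Quat:
  "tribonacci_quat n x =
     Quat (poly (tribonacci_poly n) x) (poly (tribonacci_poly (n + 1)) x)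
       (poly (tribonacci_poly (n + 2)) x) (poly (tribonacci_poly (n + 3)) x)"
  by (simp only: tribonacci_quat_def Quat_eq)

lemma tribonacci_lucas_quat_eq_Quat:
  "tribonacci_lucas_quat n x =
     Quat (poly (tribonacci_lucas_poly n) x) (poly (tribonacci_lucas_poly (n + 1)) x)
       (poly (tribonacci_lucas_poly (n + 2)) x) (poly (tribonacci_lucas_poly (n + 3)) x)"
  by (simp only: tribonacci_lucas_quat_def Quat_eq)

text \<open>
  The shape of the right-hand sides below, with scalars on the right and an explicit factor \<open>1\<close>,
  is that of the general recurrence above, so that they can be resolved with it directly.
\<close>

lemma tribonacci_quat_rec:
  "tribonacci_quat (n + 3) x = tribonacci_quat (n + 2) x * of_real (x ^ 2)
     + tribonacci_quat (n + 1) x * of_real x + tribonacci_quat n x * 1"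
  unfolding tribonacci_quat_eq_Quat of_real_eq_Quat
  by (simp add: numeral_2_eq_2 numeral_3_eq_3 times_quat_def plus_quat_def
      one_quat_def poly_monom)

lemma tribonacci_lucas_quat_rec:
  "tribonacci_lucas_quat (n + 3) x = tribonacci_lucas_quat (n + 2) x * of_real (x ^ 2)
     + tribonacci_lucas_quat (n + 1) x * of_real x + tribonacci_lucas_quat n x * 1"
  unfolding tribonacci_lucas_quat_eq_Quat of_real_eq_Quat
  by (simp add: numeral_2_eq_2 numeral_3_eq_3 times_quat_def plus_quat_def
      one_quat_def poly_monom)

theorem theorem2p4:
  fixes x :: real
  assumes "x > 0"
  shows "let X = fps_const (of_real x :: quat); y = fps_X;
             I = fps_const quat_i; J = fps_const quat_j; K = fps_const quat_k
         in tribonacci_quat_gf x =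
              (y + I + (X^2 + X * y + y^2) * J + (X^4 + X + X^3 * y + y + X^2 * y^2) * K)
              * inverse (1 - X^2 * y - X * y^2 - y^3)
          \<and> tribonacci_lucas_quat_gf x =
              (3 - 2 * X^2 * y - X * y^2
               + (X^2 + 2 * X * y + 3 * y^2) * I
               + (X^4 + 2 * X + X^3 * y + 3 * y + X^2 * y^2) * J
               + (X^6 + 3 * X^3 + 3 + X^5 * y + 3 * X^2 * y + X^4 * y^2 + 2 * X * y^2) * K)
              * inverse (1 - X^2 * y - X * y^2 - y^3)"
proof -
  define X y I J K where defs: "X = fps_const (of_real x :: quat)" "y = (fps_X :: quat fps)"
    "I = fps_const quat_i" "J = fps_const quat_j" "K = fps_const quat_k"
  have den: "1 - fps_const (of_real (x ^ 2) :: quat) * fps_X - fps_const (of_real x) * fps_X ^ 2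
      - fps_const 1 * fps_X ^ 3 = 1 - X^2 * y - X * y^2 - y^3"
    by (simp add: defs fps_const_power)
  have y_fps_const: "y * fps_const q = fps_const q * y" "y^2 * fps_const q = fps_const q * y^2" for q
    by (simp_all add: defs fps_mult_fps_X_commute fps_mult_fps_X_power_commute)
  let ?T = "\<lambda>n. tribonacci_quat n x" and ?t = "\<lambda>n. tribonacci_lucas_quat n x"
  \<comment> \<open>The three surviving coefficients, compared in the four real components: the real
    sequence up to index \<open>5\<close> enters, and the recurrence reduces all of it to the initial values.\<close>
  have T: "?T 0 = quat_i + of_real (x^2) * quat_j + of_real (x^4 + x) * quat_k"
    "?T 1 - ?T 0 * of_real (x^2) = 1 + of_real x * quat_j + of_real (x^3 + 1) * quat_k"
    "?T 2 - ?T 1 * of_real (x^2) - ?T 0 * of_real x = quat_j + of_real (x^2) * quat_k"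
    unfolding tribonacci_quat_eq_Quat of_real_eq_Quat
    by (simp_all add: numeral_2_eq_2 numeral_3_eq_3 poly_monom quat_eq_iff times_quat_def
        plus_quat_def minus_quat_def one_quat_def quat_i_def quat_j_def quat_k_def)
      (simp_all add: algebra_simps eval_nat_numeral)
  have t: "?t 0 = of_real 3 + of_real (x^2) * quat_i + of_real (x^4 + 2 * x) * quat_j
      + of_real (x^6 + 3 * x^3 + 3) * quat_k"
    "?t 1 - ?t 0 * of_real (x^2) = of_real (- 2 * x^2) + of_real (2 * x) * quat_i
      + of_real (x^3 + 3) * quat_j + of_real (x^5 + 3 * x^2) * quat_k"
    "?t 2 - ?t 1 * of_real (x^2) - ?t 0 * of_real x = of_real (- x) + of_real 3 * quat_i
      + of_real (x^2) * quat_j + of_real (x^4 + 2 * x) * quat_k"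
    unfolding tribonacci_lucas_quat_eq_Quat of_real_eq_Quat
    by (simp_all add: numeral_2_eq_2 numeral_3_eq_3 poly_monom quat_eq_iff times_quat_def
        plus_quat_def minus_quat_def one_quat_def quat_i_def quat_j_def quat_k_def)
      (simp_all add: algebra_simps eval_nat_numeral)
  have numT: "fps_const (?T 0) + fps_const (?T 1 - ?T 0 * of_real (x^2)) * fps_X
      + fps_const (?T 2 - ?T 1 * of_real (x^2) - ?T 0 * of_real x) * fps_X ^ 2
    = y + I + (X^2 + X * y + y^2) * J + (X^4 + X + X^3 * y + y + X^2 * y^2) * K"
    unfolding T(3) unfolding T(2) unfolding T(1)
    by (simp add: defs(1,3-5) defs(2)[symmetric] algebra_simps y_fps_const
        fps_numeral_fps_const fps_const_power
        flip: fps_const_add fps_const_sub fps_const_mult)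
  \<comment> \<open>A real scalar and a numeral commute, but both are opaque constants of a noncommutative ring
    to the ring normalisation used for the numerator.\<close>
  have two_commutes:
    "fps_const (of_real x :: quat) * (fps_const 2 * f) = fps_const 2 * (fps_const (of_real x) * f)" for f
    by (simp add: mult_2 mult_2_right distrib_left distrib_right flip: mult.assoc)
  have numt: "fps_const (?t 0) + fps_const (?t 1 - ?t 0 * of_real (x^2)) * fps_X
      + fps_const (?t 2 - ?t 1 * of_real (x^2) - ?t 0 * of_real x) * fps_X ^ 2
    = 3 - 2 * X^2 * y - X * y^2
               + (X^2 + 2 * X * y + 3 * y^2) * I
               + (X^4 + 2 * X + X^3 * y + 3 * y + X^2 * y^2) * J
               + (X^6 + 3 * X^3 + 3 + X^5 * y + 3 * X^2 * y + X^4 * y^2 + 2 * X * y^2) * K"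
    unfolding t(3) unfolding t(2) unfolding t(1)
    by (simp add: defs(1,3-5) defs(2)[symmetric] algebra_simps y_fps_const two_commutes
        fps_numeral_fps_const fps_const_power
        flip: fps_const_add fps_const_sub fps_const_mult)
  show ?thesis
    using third_order_recurrence_gf [of ?T, OF tribonacci_quat_rec]
      third_order_recurrence_gf [of ?t, OF tribonacci_lucas_quat_rec]
    unfolding numT numt den
    by (simp add: Let_def tribonacci_quat_gf_def tribonacci_lucas_quat_gf_def flip: defs)
qed

end
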